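(* Let $\phi:A\to B$ be a dense morphism between good topological algebras. a) Assume $\phi$ is relatively spectral. Then $A$ is finite if and only if $B$ is finite. b) Assume $\phi$ is completely relatively spectral. Then $A$ is stably finite if and only if $B$ is stably finite.
   Context: Algebras are complex and unital; morphisms are continuous unital algebra homomorphisms; subalgebras contain the unit. A topological algebra is good if its group of invertibles $A^\times$ is open and inversion $a\mapsto a^{-1}$ is continuous on $A^\times$. $\mathrm{sp}_A(a)$ denotes the spectrum of $a$ in $A$. A morphism $\phi:A\to B$ is dense if $\phi(A)$ is dense in $B$. It is relatively spectral if there is a dense subalgebra $X$ of $A$ with $\mathrm{sp}_B(\phi(x))=\mathrm{sp}_A(x)$ for all $x\in X$ (equivalently, for $x\in X$: $x$ is invertible in $A$ iff $\phi(x)$ is invertible in $B$). It is completely relatively spectral if for every $n\ge1$ the amplified (entrywise) morphism $M_n(\phi):M_n(A)\to M_n(B)$ is relatively spectral. An algebra is finite if every left-invertible element is invertible (equivalently, every right-invertible element is invertible); it is stably finite if each matrix algebra $M_n(A)$, $n\ge1$, is finite. *)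

theory Defs
  imports "HOL-Analysis.Analysis" "HOL-Algebra.Subrings" "HOL-Algebra.Module"
    "HOL-Algebra.Algebraic_Closure_Type"
begin

text \<open>
  Algebras are records with explicit carriers, rather than types of some class, because
  the matrix algebras over an algebra, of all sizes, have to be algebras of the same kind.
\<close>

abbreviation complex_field :: "complex ring"
  where "complex_field \<equiv> ring_of_type_algebra"

record 'a top_algebra = "(complex, 'a) module" +
  topo :: "'a topology"

text \<open>
  The library locale \<open>algebra\<close> demands commutativity of the multiplication, hence the
  following noncommutative version.
\<close>

locale complex_algebra = ring A + module complex_field A
  for A :: "'a top_algebra" (structure) +
  assumes smult_mult_left:
      "\<lbrakk>x \<in> carrier A; y \<in> carrier A\<rbrakk> \<Longrightarrow> (c \<odot> x) \<otimes> y = c \<odot> (x \<otimes> y)"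
    and smult_mult_right:
      "\<lbrakk>x \<in> carrier A; y \<in> carrier A\<rbrakk> \<Longrightarrow> x \<otimes> (c \<odot> y) = c \<odot> (x \<otimes> y)"

text \<open>Multiplication is jointly continuous; no separation axiom is imposed.\<close>

locale topological_algebra = complex_algebra +
  assumes topspace_topo: "topspace (topo A) = carrier A"
    and continuous_add:
      "continuous_map (prod_topology (topo A) (topo A)) (topo A) (\<lambda>(x, y). x \<oplus> y)"
    and continuous_smult:
      "continuous_map (prod_topology euclidean (topo A)) (topo A) (\<lambda>(c, x). c \<odot> x)"
    and continuous_mult:
      "continuous_map (prod_topology (topo A) (topo A)) (topo A) (\<lambda>(x, y). x \<otimes> y)"

locale good_topological_algebra = topological_algebra +
  assumes open_Units: "openin (topo A) (Units A)"
    and continuous_inv: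
      "continuous_map (subtopology (topo A) (Units A)) (topo A) (\<lambda>x. inv x)"

definition subalgebra_of :: "'a set \<Rightarrow> 'a top_algebra \<Rightarrow> bool" where
  "subalgebra_of S A \<longleftrightarrow> subring S A \<and> submodule S complex_field A"

definition dense_subset :: "'a set \<Rightarrow> 'a top_algebra \<Rightarrow> bool" where
  "dense_subset S A \<longleftrightarrow> S \<subseteq> carrier A \<and> topo A closure_of S = carrier A"

text \<open>The maps in \<^const>\<open>ring_hom\<close> preserve the unit.\<close>

definition morphism :: "'a top_algebra \<Rightarrow> 'b top_algebra \<Rightarrow> ('a \<Rightarrow> 'b) \<Rightarrow> bool" where
  "morphism A B \<phi> \<longleftrightarrow> \<phi> \<in> ring_hom A B \<and>
     (\<forall>c. \<forall>x\<in>carrier A. \<phi> (c \<odot>\<^bsub>A\<^esub> x) = c \<odot>\<^bsub>B\<^esub> \<phi> x) \<and>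
     continuous_map (topo A) (topo B) \<phi>"

definition dense_morphism :: "'a top_algebra \<Rightarrow> 'b top_algebra \<Rightarrow> ('a \<Rightarrow> 'b) \<Rightarrow> bool" where
  "dense_morphism A B \<phi> \<longleftrightarrow> morphism A B \<phi> \<and> dense_subset (\<phi> ` carrier A) B"

definition spectrum_in :: "'a top_algebra \<Rightarrow> 'a \<Rightarrow> complex set" where
  "spectrum_in A a = {c. a \<ominus>\<^bsub>A\<^esub> (c \<odot>\<^bsub>A\<^esub> \<one>\<^bsub>A\<^esub>) \<notin> Units A}"

definition relatively_spectral :: "'a top_algebra \<Rightarrow> 'b top_algebra \<Rightarrow> ('a \<Rightarrow> 'b) \<Rightarrow> bool" where
  "relatively_spectral A B \<phi> \<longleftrightarrow>
     (\<exists>S. subalgebra_of S A \<and> dense_subset S A \<and>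
        (\<forall>x\<in>S. spectrum_in B (\<phi> x) = spectrum_in A x))"

text \<open>
  An \<open>n \<times> n\<close> matrix is a function on pairs of indices below \<open>n\<close>, equal to
  \<^const>\<open>undefined\<close> on all other pairs; this is the carrier on which
  \<^const>\<open>product_topology\<close> lives.
\<close>

abbreviation mat_indices :: "nat \<Rightarrow> (nat \<times> nat) set"
  where "mat_indices n \<equiv> {..<n} \<times> {..<n}"

definition matrix_algebra :: "nat \<Rightarrow> 'a top_algebra \<Rightarrow> (nat \<times> nat \<Rightarrow> 'a) top_algebra" where
  "matrix_algebra n A =
     \<lparr>carrier = mat_indices n \<rightarrow>\<^sub>E carrier A,
      mult = (\<lambda>M N. \<lambda>(i, j)\<in>mat_indices n. \<Oplus>\<^bsub>A\<^esub>k\<in>{..<n}. M (i, k) \<otimes>\<^bsub>A\<^esub> N (k, j)),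
      one = (\<lambda>(i, j)\<in>mat_indices n. if i = j then \<one>\<^bsub>A\<^esub> else \<zero>\<^bsub>A\<^esub>),
      zero = (\<lambda>p\<in>mat_indices n. \<zero>\<^bsub>A\<^esub>),
      add = (\<lambda>M N. \<lambda>p\<in>mat_indices n. M p \<oplus>\<^bsub>A\<^esub> N p),
      smult = (\<lambda>c M. \<lambda>p\<in>mat_indices n. c \<odot>\<^bsub>A\<^esub> M p),
      topo = product_topology (\<lambda>_. topo A) (mat_indices n)\<rparr>"

definition matrix_map :: "nat \<Rightarrow> ('a \<Rightarrow> 'b) \<Rightarrow> (nat \<times> nat \<Rightarrow> 'a) \<Rightarrow> (nat \<times> nat \<Rightarrow> 'b)" where
  "matrix_map n \<phi> M = (\<lambda>p\<in>mat_indices n. \<phi> (M p))"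

definition completely_relatively_spectral ::
    "'a top_algebra \<Rightarrow> 'b top_algebra \<Rightarrow> ('a \<Rightarrow> 'b) \<Rightarrow> bool" where
  "completely_relatively_spectral A B \<phi> \<longleftrightarrow>
     (\<forall>n\<ge>1. relatively_spectral (matrix_algebra n A) (matrix_algebra n B) (matrix_map n \<phi>))"

definition finite_algebra :: "'a top_algebra \<Rightarrow> bool" where
  "finite_algebra A \<longleftrightarrow>
     (\<forall>a\<in>carrier A. (\<exists>b\<in>carrier A. b \<otimes>\<^bsub>A\<^esub> a = \<one>\<^bsub>A\<^esub>) \<longrightarrow> a \<in> Units A)"

definition stably_finite_algebra :: "'a top_algebra \<Rightarrow> bool" where
  "stably_finite_algebra A \<longleftrightarrow> (\<forall>n\<ge>1. finite_algebra (matrix_algebra n A))"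

end

theory Submission
  imports Defs
begin

text \<open>
  Only the openness of the groups of units matters for part a). Let \<open>b a = 1\<close> in \<open>B\<close>. For \<open>x\<close> in
  the dense subalgebra with \<open>\<phi> x\<close> close to \<open>a\<close>, the element \<open>b \<phi>(x)\<close> is a unit, and for \<open>y\<close> with
  \<open>\<phi> y\<close> close to \<open>b\<close>, so is \<open>\<phi>(y x)\<close>. Hence \<open>y x\<close> is a unit of \<open>A\<close>, and so is \<open>x\<close> if \<open>A\<close> is
  finite; then \<open>\<phi> x\<close>, \<open>b\<close> and \<open>a\<close> are units. Conversely, if \<open>b a = 1\<close> in \<open>A\<close> and \<open>B\<close> is finite, then
  \<open>\<phi> a\<close> is a unit, hence also \<open>\<phi> x\<close> and \<open>b x\<close> for \<open>x\<close> close to \<open>a\<close>; thus \<open>x\<close>, \<open>b\<close> and \<open>a\<close> are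
  units. Part b) is part a) for matrix algebras, whose units form an open set because column
  elimination works near the identity matrix; this uses the continuity of the inversion.
\<close>

section \<open>Algebras with open group of units\<close>

text \<open>Provides the premise under which facts about rings are applied to \<open>A\<close>
  explicitly within this locale.\<close>

lemma (in complex_algebra) algebra_ring: "ring A"
  by unfold_locales

context topological_algebra
begin

lemma continuous_map_into_carrier:
  "\<lbrakk>continuous_map T (topo A) f; x \<in> topspace T\<rbrakk> \<Longrightarrow> f x \<in> carrier A"
  using continuous_map_image_subset_topspace topspace_topo by fastforce

lemma continuous_map_add:
  assumes "continuous_map T (topo A) f" "continuous_map T (topo A) g"
  shows "continuous_map T (topo A) (\<lambda>x. f x \<oplus> g x)"
  using continuous_map_compose[OF continuous_map_pairedI[OF assms] continuous_add]
  by (simp add: o_def)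

lemma continuous_map_mult:
  assumes "continuous_map T (topo A) f" "continuous_map T (topo A) g"
  shows "continuous_map T (topo A) (\<lambda>x. f x \<otimes> g x)"
  using continuous_map_compose[OF continuous_map_pairedI[OF assms] continuous_mult]
  by (simp add: o_def)

lemma continuous_map_smult:
  assumes "continuous_map T euclidean c" "continuous_map T (topo A) f"
  shows "continuous_map T (topo A) (\<lambda>x. c x \<odot> f x)"
  using continuous_map_compose[OF continuous_map_pairedI[OF assms] continuous_smult]
  by (simp add: o_def)

text \<open>The axioms of a topological algebra do not mention negation. Written as multiplication
  by the scalar -1, it inherits continuity from \<open>continuous_smult\<close>.\<close>

lemma smult_minus_one:
  assumes "x \<in> carrier A"
  shows "(-1) \<odot> x = \<ominus> x"
proof -
  have "\<ominus>\<^bsub>complex_field\<^esub> 1 = -1"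
    by (rule R.minus_equality) (simp_all add: ring_of_type_algebra_def)
  moreover have "\<ominus>\<^bsub>complex_field\<^esub> 1 \<odot> x = \<ominus> (1 \<odot> x)"
    using assms by (intro smult_l_minus) (simp_all add: ring_of_type_algebra_def)
  ultimately show ?thesis
    using smult_one[OF assms] by (simp add: ring_of_type_algebra_def)
qed

lemma continuous_map_a_inv:
  assumes "continuous_map T (topo A) f"
  shows "continuous_map T (topo A) (\<lambda>x. \<ominus> f x)"
proof -
  have "continuous_map T (topo A) (\<lambda>x. (-1) \<odot> f x)"
    using assms by (intro continuous_map_smult) auto
  then show ?thesis
    by (rule continuous_map_eq) (simp add: smult_minus_one continuous_map_into_carrier[OF assms])
qed

lemma continuous_map_finsum:
  assumes "finite K" "\<And>k. k \<in> K \<Longrightarrow> continuous_map T (topo A) (f k)"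
  shows "continuous_map T (topo A) (\<lambda>x. \<Oplus>k\<in>K. f k x)"
  using assms
proof (induction K)
  case empty
  show ?case
    using topspace_topo by simp
next
  case (insert k K)
  have "continuous_map T (topo A) (\<lambda>x. f k x \<oplus> (\<Oplus>k\<in>K. f k x))"
    using insert by (intro continuous_map_add) auto
  moreover have "f k x \<oplus> (\<Oplus>k\<in>K. f k x) = (\<Oplus>k\<in>insert k K. f k x)" if "x \<in> topspace T" for x
    using insert that
    by (intro abelian_monoid.finsum_insert[symmetric] abelian_group.axioms(1)
        ring.is_abelian_group algebra_ring) (auto intro: continuous_map_into_carrier)
  ultimately show ?case
    by (rule continuous_map_eq)
qed

end

text \<open>The class in which finiteness is transferred. Good algebras belong to it, and so do the
  matrix algebras over them, so that one theorem serves both parts.\<close>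

locale open_units_algebra = topological_algebra +
  assumes open_Units: "openin (topo A) (Units A)"

sublocale good_topological_algebra \<subseteq> open_units_algebra
  by unfold_locales (rule open_Units)

context open_units_algebra
begin

lemma open_right_mult_Units:
  assumes "b \<in> carrier A"
  shows "openin (topo A) {x \<in> carrier A. x \<otimes> b \<in> Units A}"
proof -
  have "continuous_map (topo A) (topo A) (\<lambda>x. x \<otimes> b)"
    using continuous_map_mult[of "topo A" "\<lambda>x. x" "\<lambda>_. b"] assms topspace_topo by simp
  then show ?thesis
    using openin_continuous_map_preimage[OF _ open_Units] topspace_topo by fastforce
qed

lemma open_left_mult_Units:
  assumes "b \<in> carrier A"
  shows "openin (topo A) {x \<in> carrier A. b \<otimes> x \<in> Units A}"
proof -
  have "continuous_map (topo A) (topo A) (\<lambda>x. b \<otimes> x)"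
    using continuous_map_mult[of "topo A" "\<lambda>_. b" "\<lambda>x. x"] assms topspace_topo by simp
  then show ?thesis
    using openin_continuous_map_preimage[OF _ open_Units] topspace_topo by fastforce
qed

end

text \<open>Converts equality of spectra into the form used below: on the dense subalgebra, \<phi>
  preserves and reflects invertibility.\<close>

lemma (in complex_algebra) zero_in_spectrum_iff:
  assumes "a \<in> carrier A"
  shows "0 \<in> spectrum_in A a \<longleftrightarrow> a \<notin> Units A"
proof -
  have "0 \<odot> \<one> = \<zero>"
    using smult_l_null[of \<one>] by (simp add: ring_of_type_algebra_def)
  then show ?thesis
    using assms by (simp add: spectrum_in_def a_minus_def)
qed

lemma (in monoid) Units_cancel_right:
  assumes "x \<otimes> y \<in> Units G" "y \<in> Units G" "x \<in> carrier G"
  shows "x \<in> Units G"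
proof -
  have "x = (x \<otimes> y) \<otimes> inv y"
    using assms by (simp add: m_assoc Units_closed)
  then show ?thesis
    using assms by (metis Units_m_closed Units_inv_Units)
qed

lemma (in monoid) Units_cancel_left:
  assumes "x \<otimes> y \<in> Units G" "x \<in> Units G" "y \<in> carrier G"
  shows "y \<in> Units G"
proof -
  have "y = inv x \<otimes> (x \<otimes> y)"
    using assms by (simp add: m_assoc[symmetric] Units_closed)
  then show ?thesis
    using assms by (metis Units_m_closed Units_inv_Units)
qed

section \<open>Approximation and transfer of finiteness\<close>

lemma dense_subset_meets_open:
  assumes "topological_algebra A" "dense_subset S A" "openin (topo A) U" "u \<in> U"
  obtains x where "x \<in> S" "x \<in> U"
proof -
  have "topo A closure_of S = topspace (topo A)"
    using assms(1,2) topological_algebra.topspace_topo by (fastforce simp: dense_subset_def)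
  then show ?thesis
    using that assms(3,4) unfolding dense_intersects_open by blast
qed

theorem finite_algebra_iff:
  assumes "open_units_algebra A" and "open_units_algebra B"
    and "dense_morphism A B \<phi>" and "relatively_spectral A B \<phi>"
  shows "finite_algebra A \<longleftrightarrow> finite_algebra B"
proof -
  interpret RA: ring A
    using assms(1) by (simp add: open_units_algebra_def topological_algebra_def complex_algebra_def)
  interpret RB: ring B
    using assms(2) by (simp add: open_units_algebra_def topological_algebra_def complex_algebra_def)
  interpret A: open_units_algebra A by fact
  interpret B: open_units_algebra B by fact
  have hom: "\<phi> \<in> ring_hom A B" and cont: "continuous_map (topo A) (topo B) \<phi>"
    and dense: "dense_subset (\<phi> ` carrier A) B"
    using assms(3) by (auto simp: dense_morphism_def morphism_def)
  obtain S where S: "subring S A" "dense_subset S A"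
    and sp: "\<And>x. x \<in> S \<Longrightarrow> spectrum_in B (\<phi> x) = spectrum_in A x"
    using assms(4) by (auto simp: relatively_spectral_def subalgebra_of_def)
  have S_carrier: "x \<in> carrier A" if "x \<in> S" for x
    using subringE(1)[OF S(1)] that by blast
  have Units_iff: "\<phi> x \<in> Units B \<longleftrightarrow> x \<in> Units A" if "x \<in> S" for x
    using sp[OF that] A.zero_in_spectrum_iff[of x] B.zero_in_spectrum_iff[of "\<phi> x"]
      S_carrier[OF that] ring_hom_closed[OF hom] by auto
  have preimage: "openin (topo A) {x \<in> carrier A. \<phi> x \<in> U}" if "openin (topo B) U" for U
    using openin_continuous_map_preimage[OF cont that] by (simp add: A.topspace_topo)
  \<comment> \<open>The image of \<open>S\<close> is dense in \<open>B\<close>: since \<phi> has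
    dense range, the preimage of \<open>U\<close> is nonempty, and it is open by continuity, so it
    meets \<open>S\<close>.\<close>
  have meets: "\<exists>x\<in>S. \<phi> x \<in> U" if "openin (topo B) U" "u \<in> U" for U u
  proof -
    obtain y where "y \<in> \<phi> ` carrier A" "y \<in> U"
      using dense_subset_meets_open[OF B.topological_algebra_axioms dense \<open>openin (topo B) U\<close> \<open>u \<in> U\<close>] .
    then obtain x where "x \<in> {x \<in> carrier A. \<phi> x \<in> U}"
      by blast
    then show ?thesis
      using dense_subset_meets_open[OF A.topological_algebra_axioms S(2) preimage[OF that(1)]] by blast
  qed
  show ?thesis
  proof
    assume fin: "finite_algebra A"
    show "finite_algebra B"
      unfolding finite_algebra_def
    proof (intro ballI impI)
      fix a assume a: "a \<in> carrier B" and "\<exists>b\<in>carrier B. b \<otimes>\<^bsub>B\<^esub> a = \<one>\<^bsub>B\<^esub>"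
      then obtain b where b: "b \<in> carrier B" "b \<otimes>\<^bsub>B\<^esub> a = \<one>\<^bsub>B\<^esub>"
        by blast
      have "a \<in> {x \<in> carrier B. b \<otimes>\<^bsub>B\<^esub> x \<in> Units B}"
        using a b by simp
      then obtain x where x: "x \<in> S" "b \<otimes>\<^bsub>B\<^esub> \<phi> x \<in> Units B"
        using meets[OF B.open_left_mult_Units[OF b(1)]] by blast
      have \<phi>x: "\<phi> x \<in> carrier B"
        using x(1) S_carrier ring_hom_closed[OF hom] by blast
      \<comment> \<open>The second approximation is made with \<open>x\<close> already fixed: the
        open set depends on \<open>x\<close>, and it contains \<open>b\<close> by the choice of
        \<open>x\<close>.\<close>
      have "b \<in> {y \<in> carrier B. y \<otimes>\<^bsub>B\<^esub> \<phi> x \<in> Units B}"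
        using b x by simp
      then obtain y where y: "y \<in> S" "\<phi> y \<otimes>\<^bsub>B\<^esub> \<phi> x \<in> Units B"
        using meets[OF B.open_right_mult_Units[OF \<phi>x]] by blast
      have xy: "x \<in> carrier A" "y \<in> carrier A"
        using x y S_carrier by auto
      \<comment> \<open>Both factors were taken from \<open>S\<close>, so their product lies in
        \<open>S\<close> and its invertibility can be pulled back from \<open>B\<close>.\<close>
      have "y \<otimes>\<^bsub>A\<^esub> x \<in> Units A"
        using Units_iff[OF subringE(6)[OF S(1) y(1) x(1)]] y(2) ring_hom_mult[OF hom xy(2,1)] by simp
      \<comment> \<open>This exhibits a left inverse of \<open>x\<close>, to which finiteness of
        \<open>A\<close> applies.\<close>
      then have "(inv\<^bsub>A\<^esub> (y \<otimes>\<^bsub>A\<^esub> x) \<otimes>\<^bsub>A\<^esub> y) \<otimes>\<^bsub>A\<^esub> x = \<one>\<^bsub>A\<^esub>"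
        using xy by (simp add: RA.m_assoc)
      then have "x \<in> Units A"
        using fin xy \<open>y \<otimes>\<^bsub>A\<^esub> x \<in> Units A\<close> unfolding finite_algebra_def
        by (meson RA.m_closed RA.Units_inv_closed)
      then have "b \<in> Units B"
        using RB.Units_cancel_right[OF x(2) _ b(1)] Units_iff[OF x(1)] by simp
      then show "a \<in> Units B"
        using RB.Units_cancel_left[of b a] a b by simp
    qed
  next
    assume fin: "finite_algebra B"
    show "finite_algebra A"
      unfolding finite_algebra_def
    proof (intro ballI impI)
      fix a assume a: "a \<in> carrier A" and "\<exists>b\<in>carrier A. b \<otimes>\<^bsub>A\<^esub> a = \<one>\<^bsub>A\<^esub>"
      then obtain b where b: "b \<in> carrier A" "b \<otimes>\<^bsub>A\<^esub> a = \<one>\<^bsub>A\<^esub>"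
        by blast
      have "\<phi> b \<otimes>\<^bsub>B\<^esub> \<phi> a = \<one>\<^bsub>B\<^esub>"
        using ring_hom_mult[OF hom b(1) a] ring_hom_one[OF hom] b(2) by simp
      then have "\<phi> a \<in> Units B"
        using fin a b(1) ring_hom_closed[OF hom] unfolding finite_algebra_def by blast
      \<comment> \<open>One approximant has to satisfy both open conditions: the second makes
        \<open>x\<close> a unit of \<open>A\<close>, and the first then passes invertibility on to
        \<open>b\<close>.\<close>
      then have "a \<in> {x \<in> carrier A. b \<otimes>\<^bsub>A\<^esub> x \<in> Units A} \<inter> {x \<in> carrier A. \<phi> x \<in> Units B}"
        using a b by simp
      then obtain x where x: "x \<in> S" "b \<otimes>\<^bsub>A\<^esub> x \<in> Units A" "\<phi> x \<in> Units B"
        using dense_subset_meets_open[OF A.topological_algebra_axioms S(2)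
          openin_Int[OF A.open_left_mult_Units[OF b(1)] preimage[OF B.open_Units]]] by blast
      have "b \<in> Units A"
        using RA.Units_cancel_right[OF x(2) _ b(1)] Units_iff[OF x(1)] x(3) by simp
      then show "a \<in> Units A"
        using RA.Units_cancel_left[of b a] a b by simp
    qed
  qed
qed

section \<open>Matrix algebras\<close>

lemma (in abelian_monoid) finsum_swap:
  assumes "finite I" "finite J" "\<And>i j. \<lbrakk>i \<in> I; j \<in> J\<rbrakk> \<Longrightarrow> f i j \<in> carrier G"
  shows "(\<Oplus>i\<in>I. \<Oplus>j\<in>J. f i j) = (\<Oplus>j\<in>J. \<Oplus>i\<in>I. f i j)"
  using assms(1,3)
proof (induction I)
  case empty
  show ?case
    by simp
next
  case (insert i I)
  have "(\<Oplus>i\<in>insert i I. \<Oplus>j\<in>J. f i j) = (\<Oplus>j\<in>J. f i j) \<oplus> (\<Oplus>i\<in>I. \<Oplus>j\<in>J. f i j)"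
    using insert by (intro finsum_insert) (auto intro!: finsum_closed)
  also have "\<dots> = (\<Oplus>j\<in>J. f i j) \<oplus> (\<Oplus>j\<in>J. \<Oplus>i\<in>I. f i j)"
    using insert by simp
  also have "\<dots> = (\<Oplus>j\<in>J. f i j \<oplus> (\<Oplus>i\<in>I. f i j))"
    using insert by (intro finsum_addf[symmetric]) (auto intro!: finsum_closed)
  also have "\<dots> = (\<Oplus>j\<in>J. \<Oplus>i\<in>insert i I. f i j)"
    using insert by (intro finsum_cong' refl finsum_insert[symmetric]) (auto intro!: finsum_closed)
  finally show ?case .
qed

section \<open>Matrices over a ring\<close>

lemma matrix_carrier: "carrier (matrix_algebra n A) = mat_indices n \<rightarrow>\<^sub>E carrier A"
  and matrix_topo: "topo (matrix_algebra n A) = product_topology (\<lambda>_. topo A) (mat_indices n)"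
  by (simp_all add: matrix_algebra_def)

lemma matrix_entries:
  assumes "i < n" "j < n"
  shows "(M \<otimes>\<^bsub>matrix_algebra n A\<^esub> N) (i, j) = (\<Oplus>\<^bsub>A\<^esub>k\<in>{..<n}. M (i, k) \<otimes>\<^bsub>A\<^esub> N (k, j))"
    and "\<one>\<^bsub>matrix_algebra n A\<^esub> (i, j) = (if i = j then \<one>\<^bsub>A\<^esub> else \<zero>\<^bsub>A\<^esub>)"
    and "\<zero>\<^bsub>matrix_algebra n A\<^esub> (i, j) = \<zero>\<^bsub>A\<^esub>"
    and "(M \<oplus>\<^bsub>matrix_algebra n A\<^esub> N) (i, j) = M (i, j) \<oplus>\<^bsub>A\<^esub> N (i, j)"
    and "(c \<odot>\<^bsub>matrix_algebra n A\<^esub> M) (i, j) = c \<odot>\<^bsub>A\<^esub> M (i, j)"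
  using assms by (simp_all add: matrix_algebra_def)

lemma matrix_eqI:
  assumes "M \<in> carrier (matrix_algebra n A)" "N \<in> carrier (matrix_algebra n A)"
    and "\<And>i j. \<lbrakk>i < n; j < n\<rbrakk> \<Longrightarrow> M (i, j) = N (i, j)"
  shows "M = N"
  using assms(3) by (intro PiE_ext[OF assms(1,2)[unfolded matrix_carrier]]) auto

lemma matrix_entry_closed:
  "\<lbrakk>M \<in> carrier (matrix_algebra n A); i < n; j < n\<rbrakk> \<Longrightarrow> M (i, j) \<in> carrier A"
  by (auto simp: matrix_carrier)

text \<open>A Gauss transformation (Frobenius matrix). As a left factor it multiplies row
  \<open>k\<close> by \<open>v k\<close> from the left and adds \<open>v i\<close> times the old row
  \<open>k\<close> to every other row \<open>i\<close>.\<close>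

definition column_matrix :: "'a top_algebra \<Rightarrow> nat \<Rightarrow> nat \<Rightarrow> (nat \<Rightarrow> 'a) \<Rightarrow> nat \<times> nat \<Rightarrow> 'a" where
  "column_matrix A n k v =
     (\<lambda>(i, j)\<in>mat_indices n. if j = k then v i else if i = j then \<one>\<^bsub>A\<^esub> else \<zero>\<^bsub>A\<^esub>)"

text \<open>Left multiplication by \<open>column_matrix A n k (pivot_column A k M)\<close> turns the \<open>k\<close>-th column
  of \<open>M\<close> into that of the identity.\<close>

definition pivot_column :: "'a top_algebra \<Rightarrow> nat \<Rightarrow> (nat \<times> nat \<Rightarrow> 'a) \<Rightarrow> nat \<Rightarrow> 'a" where
  "pivot_column A k M i =
     (if i = k then inv\<^bsub>A\<^esub> M (k, k) else \<ominus>\<^bsub>A\<^esub> (M (i, k) \<otimes>\<^bsub>A\<^esub> inv\<^bsub>A\<^esub> M (k, k)))"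

text \<open>
  Inside \<^locale>\<open>complex_algebra\<close> the facts about rings are shadowed by their instances for
  \<^term>\<open>complex_field\<close>; therefore purely ring-theoretic results are stated outside that locale.
\<close>

context
  fixes A :: "'a top_algebra" (structure)
  assumes ring: "ring A"
begin

interpretation ring A
  by (rule ring)

lemma matrix_closed [intro, simp]:
  shows "\<lbrakk>M \<in> carrier (matrix_algebra n A); N \<in> carrier (matrix_algebra n A)\<rbrakk> \<Longrightarrow>
      M \<otimes>\<^bsub>matrix_algebra n A\<^esub> N \<in> carrier (matrix_algebra n A)"
    and "\<one>\<^bsub>matrix_algebra n A\<^esub> \<in> carrier (matrix_algebra n A)"
    and "\<zero>\<^bsub>matrix_algebra n A\<^esub> \<in> carrier (matrix_algebra n A)"
    and "\<lbrakk>M \<in> carrier (matrix_algebra n A); N \<in> carrier (matrix_algebra n A)\<rbrakk> \<Longrightarrow>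
      M \<oplus>\<^bsub>matrix_algebra n A\<^esub> N \<in> carrier (matrix_algebra n A)"
  by (auto simp: matrix_algebra_def intro!: finsum_closed)

lemma matrix_mult_assoc:
  assumes "M \<in> carrier (matrix_algebra n A)" "N \<in> carrier (matrix_algebra n A)"
    "P \<in> carrier (matrix_algebra n A)"
  shows "(M \<otimes>\<^bsub>matrix_algebra n A\<^esub> N) \<otimes>\<^bsub>matrix_algebra n A\<^esub> P =
    M \<otimes>\<^bsub>matrix_algebra n A\<^esub> (N \<otimes>\<^bsub>matrix_algebra n A\<^esub> P)"
proof (rule matrix_eqI)
  fix i j assume ij: "i < n" "j < n"
  note closed = assms[THEN matrix_entry_closed]
  have "(\<Oplus>k\<in>{..<n}. (\<Oplus>l\<in>{..<n}. M (i, l) \<otimes> N (l, k)) \<otimes> P (k, j)) =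
      (\<Oplus>k\<in>{..<n}. \<Oplus>l\<in>{..<n}. M (i, l) \<otimes> N (l, k) \<otimes> P (k, j))"
    using ij closed by (intro finsum_cong' refl finsum_ldistr) (auto intro!: finsum_closed)
  also have "\<dots> = (\<Oplus>l\<in>{..<n}. \<Oplus>k\<in>{..<n}. M (i, l) \<otimes> N (l, k) \<otimes> P (k, j))"
    using ij closed by (intro finsum_swap) auto
  also have "\<dots> = (\<Oplus>l\<in>{..<n}. \<Oplus>k\<in>{..<n}. M (i, l) \<otimes> (N (l, k) \<otimes> P (k, j)))"
    using ij closed by (intro finsum_cong' refl m_assoc) (auto intro!: finsum_closed)
  also have "\<dots> = (\<Oplus>l\<in>{..<n}. M (i, l) \<otimes> (\<Oplus>k\<in>{..<n}. N (l, k) \<otimes> P (k, j)))"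
    using ij closed by (intro finsum_cong' refl finsum_rdistr[symmetric]) (auto intro!: finsum_closed)
  finally have "(\<Oplus>k\<in>{..<n}. (\<Oplus>l\<in>{..<n}. M (i, l) \<otimes> N (l, k)) \<otimes> P (k, j)) =
      (\<Oplus>l\<in>{..<n}. M (i, l) \<otimes> (\<Oplus>k\<in>{..<n}. N (l, k) \<otimes> P (k, j)))" .
  moreover have "((M \<otimes>\<^bsub>matrix_algebra n A\<^esub> N) \<otimes>\<^bsub>matrix_algebra n A\<^esub> P) (i, j) =
      (\<Oplus>k\<in>{..<n}. (\<Oplus>l\<in>{..<n}. M (i, l) \<otimes> N (l, k)) \<otimes> P (k, j))"
    using ij closed by (auto simp: matrix_entries intro!: finsum_cong' finsum_closed)
  moreover have "(M \<otimes>\<^bsub>matrix_algebra n A\<^esub> (N \<otimes>\<^bsub>matrix_algebra n A\<^esub> P)) (i, j) =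
      (\<Oplus>l\<in>{..<n}. M (i, l) \<otimes> (\<Oplus>k\<in>{..<n}. N (l, k) \<otimes> P (k, j)))"
    using ij closed by (auto simp: matrix_entries intro!: finsum_cong' finsum_closed)
  ultimately show "((M \<otimes>\<^bsub>matrix_algebra n A\<^esub> N) \<otimes>\<^bsub>matrix_algebra n A\<^esub> P) (i, j) =
      (M \<otimes>\<^bsub>matrix_algebra n A\<^esub> (N \<otimes>\<^bsub>matrix_algebra n A\<^esub> P)) (i, j)"
    by simp
qed (use assms in auto)

lemma ring_matrix: "ring (matrix_algebra n A)"
proof (rule ringI)
  let ?M = "matrix_algebra n A"
  show "abelian_group ?M"
  proof (rule abelian_groupI)
    fix x assume x: "x \<in> carrier ?M"
    define y where "y = (\<lambda>p\<in>mat_indices n. \<ominus> x p)"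
    have y: "y \<in> carrier ?M"
      using x by (auto simp: y_def matrix_carrier)
    moreover have "y \<oplus>\<^bsub>?M\<^esub> x = \<zero>\<^bsub>?M\<^esub>"
      using x y by (intro matrix_eqI) (auto simp: matrix_entries y_def matrix_entry_closed[OF x] l_neg)
    ultimately show "\<exists>y\<in>carrier ?M. y \<oplus>\<^bsub>?M\<^esub> x = \<zero>\<^bsub>?M\<^esub>"
      by blast
  next
    fix x y z assume xyz: "x \<in> carrier ?M" "y \<in> carrier ?M" "z \<in> carrier ?M"
    show "x \<oplus>\<^bsub>?M\<^esub> y \<oplus>\<^bsub>?M\<^esub> z = x \<oplus>\<^bsub>?M\<^esub> (y \<oplus>\<^bsub>?M\<^esub> z)"
      using xyz by (intro matrix_eqI) (auto simp: matrix_entries xyz[THEN matrix_entry_closed] a_assoc)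
  next
    fix x y assume xy: "x \<in> carrier ?M" "y \<in> carrier ?M"
    show "x \<oplus>\<^bsub>?M\<^esub> y = y \<oplus>\<^bsub>?M\<^esub> x"
      using xy by (intro matrix_eqI) (auto simp: matrix_entries xy[THEN matrix_entry_closed] a_comm)
  next
    fix x assume x: "x \<in> carrier ?M"
    show "\<zero>\<^bsub>?M\<^esub> \<oplus>\<^bsub>?M\<^esub> x = x"
      using x by (intro matrix_eqI) (auto simp: matrix_entries matrix_entry_closed[OF x])
  qed auto
  show "monoid ?M"
  proof (rule monoidI)
    fix x assume x: "x \<in> carrier ?M"
    show "\<one>\<^bsub>?M\<^esub> \<otimes>\<^bsub>?M\<^esub> x = x"
    proof (rule matrix_eqI)
      fix i j assume ij: "i < n" "j < n"
      \<comment> \<open>The summands are brought into the \<open>if\<close> form that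
        \<open>finsum_singleton\<close> collapses to one term.\<close>
      have "(\<one>\<^bsub>?M\<^esub> \<otimes>\<^bsub>?M\<^esub> x) (i, j) = (\<Oplus>k\<in>{..<n}. if i = k then x (k, j) else \<zero>)"
        unfolding matrix_entries(1)[OF ij] using ij matrix_entry_closed[OF x]
        by (intro finsum_cong') (auto simp: matrix_entries)
      also have "\<dots> = x (i, j)"
        using ij matrix_entry_closed[OF x] by (intro finsum_singleton) auto
      finally show "(\<one>\<^bsub>?M\<^esub> \<otimes>\<^bsub>?M\<^esub> x) (i, j) = x (i, j)" .
    qed (use x in auto)
    show "x \<otimes>\<^bsub>?M\<^esub> \<one>\<^bsub>?M\<^esub> = x"
    proof (rule matrix_eqI)
      fix i j assume ij: "i < n" "j < n"
      have "(x \<otimes>\<^bsub>?M\<^esub> \<one>\<^bsub>?M\<^esub>) (i, j) = (\<Oplus>k\<in>{..<n}. if j = k then x (i, k) else \<zero>)"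
        unfolding matrix_entries(1)[OF ij] using ij matrix_entry_closed[OF x]
        by (intro finsum_cong') (auto simp: matrix_entries)
      also have "\<dots> = x (i, j)"
        using ij matrix_entry_closed[OF x] by (intro finsum_singleton) auto
      finally show "(x \<otimes>\<^bsub>?M\<^esub> \<one>\<^bsub>?M\<^esub>) (i, j) = x (i, j)" .
    qed (use x in auto)
  qed (auto intro: matrix_mult_assoc)
  fix x y z assume xyz: "x \<in> carrier ?M" "y \<in> carrier ?M" "z \<in> carrier ?M"
  note closed = xyz[THEN matrix_entry_closed]
  show "(x \<oplus>\<^bsub>?M\<^esub> y) \<otimes>\<^bsub>?M\<^esub> z = x \<otimes>\<^bsub>?M\<^esub> z \<oplus>\<^bsub>?M\<^esub> y \<otimes>\<^bsub>?M\<^esub> z"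
  proof (rule matrix_eqI)
    fix i j assume ij: "i < n" "j < n"
    have "((x \<oplus>\<^bsub>?M\<^esub> y) \<otimes>\<^bsub>?M\<^esub> z) (i, j) = (\<Oplus>k\<in>{..<n}. x (i, k) \<otimes> z (k, j) \<oplus> y (i, k) \<otimes> z (k, j))"
      unfolding matrix_entries(1)[OF ij] using ij closed
      by (intro finsum_cong') (auto simp: matrix_entries l_distr)
    also have "\<dots> = (x \<otimes>\<^bsub>?M\<^esub> z \<oplus>\<^bsub>?M\<^esub> y \<otimes>\<^bsub>?M\<^esub> z) (i, j)"
      unfolding matrix_entries[OF ij] using ij closed by (intro finsum_addf) auto
    finally show "((x \<oplus>\<^bsub>?M\<^esub> y) \<otimes>\<^bsub>?M\<^esub> z) (i, j) = (x \<otimes>\<^bsub>?M\<^esub> z \<oplus>\<^bsub>?M\<^esub> y \<otimes>\<^bsub>?M\<^esub> z) (i, j)" .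
  qed (use xyz in auto)
  show "z \<otimes>\<^bsub>?M\<^esub> (x \<oplus>\<^bsub>?M\<^esub> y) = z \<otimes>\<^bsub>?M\<^esub> x \<oplus>\<^bsub>?M\<^esub> z \<otimes>\<^bsub>?M\<^esub> y"
  proof (rule matrix_eqI)
    fix i j assume ij: "i < n" "j < n"
    have "(z \<otimes>\<^bsub>?M\<^esub> (x \<oplus>\<^bsub>?M\<^esub> y)) (i, j) = (\<Oplus>k\<in>{..<n}. z (i, k) \<otimes> x (k, j) \<oplus> z (i, k) \<otimes> y (k, j))"
      unfolding matrix_entries(1)[OF ij] using ij closed
      by (intro finsum_cong') (auto simp: matrix_entries r_distr)
    also have "\<dots> = (z \<otimes>\<^bsub>?M\<^esub> x \<oplus>\<^bsub>?M\<^esub> z \<otimes>\<^bsub>?M\<^esub> y) (i, j)"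
      unfolding matrix_entries[OF ij] using ij closed by (intro finsum_addf) auto
    finally show "(z \<otimes>\<^bsub>?M\<^esub> (x \<oplus>\<^bsub>?M\<^esub> y)) (i, j) = (z \<otimes>\<^bsub>?M\<^esub> x \<oplus>\<^bsub>?M\<^esub> z \<otimes>\<^bsub>?M\<^esub> y) (i, j)" .
  qed (use xyz in auto)
qed

section \<open>Elimination matrices\<close>

lemma column_matrix_closed:
  "(\<And>i. i < n \<Longrightarrow> v i \<in> carrier A) \<Longrightarrow> column_matrix A n k v \<in> carrier (matrix_algebra n A)"
  by (auto simp: column_matrix_def matrix_carrier)

text \<open>Row \<open>i\<close> of the left factor can be nonzero only at \<open>l = i\<close> and
  \<open>l = k\<close>, so the sum splits into two one-point sums. For \<open>i = k\<close> these
  positions coincide, and the first sum is set to zero to avoid counting the entry twice.\<close>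

lemma column_matrix_mult:
  assumes v: "\<And>i. i < n \<Longrightarrow> v i \<in> carrier A" and N: "N \<in> carrier (matrix_algebra n A)"
    and ijk: "i < n" "j < n" "k < n"
  shows "(column_matrix A n k v \<otimes>\<^bsub>matrix_algebra n A\<^esub> N) (i, j) =
    (if i = k then \<zero> else N (i, j)) \<oplus> v i \<otimes> N (k, j)"
proof -
  note closed = matrix_entry_closed[OF N]
  have "(column_matrix A n k v \<otimes>\<^bsub>matrix_algebra n A\<^esub> N) (i, j) =
      (\<Oplus>l\<in>{..<n}. (if i = l then if l = k then \<zero> else N (l, j) else \<zero>) \<oplus>
        (if k = l then v i \<otimes> N (l, j) else \<zero>))"
    unfolding matrix_entries(1)[OF ijk(1,2)] using ijk v closed
    by (intro finsum_cong') (auto simp: column_matrix_def)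
  also have "\<dots> = (\<Oplus>l\<in>{..<n}. if i = l then if l = k then \<zero> else N (l, j) else \<zero>) \<oplus>
      (\<Oplus>l\<in>{..<n}. if k = l then v i \<otimes> N (l, j) else \<zero>)"
    using ijk v closed by (intro finsum_addf) auto
  also have "(\<Oplus>l\<in>{..<n}. if i = l then if l = k then \<zero> else N (l, j) else \<zero>) =
      (if i = k then \<zero> else N (i, j))"
    using ijk v closed by (intro finsum_singleton) auto
  also have "(\<Oplus>l\<in>{..<n}. if k = l then v i \<otimes> N (l, j) else \<zero>) = v i \<otimes> N (k, j)"
    using ijk v closed by (intro finsum_singleton) auto
  finally show ?thesis .
qed

text \<open>A product of two column matrices with the same \<open>k\<close> again differs from the
  identity at most in column \<open>k\<close>; \<open>vw\<close> and \<open>off\<close> settle that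
  column. As the ring need not be commutative, the lemma is one-sided and is later applied in both
  orders.\<close>

lemma column_matrix_mult_eq_one:
  assumes v: "\<And>i. i < n \<Longrightarrow> v i \<in> carrier A" and w: "\<And>i. i < n \<Longrightarrow> w i \<in> carrier A"
    and k: "k < n" and vw: "v k \<otimes> w k = \<one>"
    and off: "\<And>i. \<lbrakk>i < n; i \<noteq> k\<rbrakk> \<Longrightarrow> w i \<oplus> v i \<otimes> w k = \<zero>"
  shows "column_matrix A n k v \<otimes>\<^bsub>matrix_algebra n A\<^esub> column_matrix A n k w = \<one>\<^bsub>matrix_algebra n A\<^esub>"
proof (rule matrix_eqI)
  fix i j assume ij: "i < n" "j < n"
  have "(column_matrix A n k v \<otimes>\<^bsub>matrix_algebra n A\<^esub> column_matrix A n k w) (i, j) =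
      (if i = k then \<zero> else column_matrix A n k w (i, j)) \<oplus> v i \<otimes> column_matrix A n k w (k, j)"
    using v w ij k by (intro column_matrix_mult column_matrix_closed)
  also have "\<dots> = \<one>\<^bsub>matrix_algebra n A\<^esub> (i, j)"
    using ij k vw off v w by (auto simp: column_matrix_def matrix_entries(2))
  finally show "(column_matrix A n k v \<otimes>\<^bsub>matrix_algebra n A\<^esub> column_matrix A n k w) (i, j) =
      \<one>\<^bsub>matrix_algebra n A\<^esub> (i, j)" .
qed (use v w in \<open>auto intro!: column_matrix_closed\<close>)

lemma pivot_column_closed:
  assumes "M \<in> carrier (matrix_algebra n A)" "k < n" "M (k, k) \<in> Units A" "i < n"
  shows "pivot_column A k M i \<in> carrier A"
  using assms matrix_entry_closed[OF assms(1,4,2)] by (auto simp: pivot_column_def)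

lemma pivot_column_matrix_Units:
  assumes M: "M \<in> carrier (matrix_algebra n A)" and k: "k < n" and u: "M (k, k) \<in> Units A"
  shows "column_matrix A n k (pivot_column A k M) \<in> Units (matrix_algebra n A)"
proof -
  \<comment> \<open>The inverse of the elimination matrix is the column matrix built from column
    \<open>k\<close> of \<open>M\<close> itself, which restores what was eliminated.\<close>
  define w where "w i = M (i, k)" for i
  have w: "w i \<in> carrier A" if "i < n" for i
    using matrix_entry_closed[OF M that k] by (simp add: w_def)
  note v = pivot_column_closed[OF M k u]
  have wk: "w k \<in> Units A"
    using u by (simp add: w_def)
  have "column_matrix A n k (pivot_column A k M) \<otimes>\<^bsub>matrix_algebra n A\<^esub> column_matrix A n k w = \<one>\<^bsub>matrix_algebra n A\<^esub>"
    using v w k wk by (intro column_matrix_mult_eq_one)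
      (auto simp: pivot_column_def w_def[symmetric] l_minus m_assoc r_neg)
  moreover have "column_matrix A n k w \<otimes>\<^bsub>matrix_algebra n A\<^esub> column_matrix A n k (pivot_column A k M) = \<one>\<^bsub>matrix_algebra n A\<^esub>"
    using v w k wk by (intro column_matrix_mult_eq_one)
      (auto simp: pivot_column_def w_def[symmetric] l_neg)
  ultimately show ?thesis
    using v w unfolding Units_def by (auto intro!: column_matrix_closed)
qed

text \<open>The columns \<open>j < k\<close> survive because row \<open>k\<close> vanishes there, so
  adding multiples of it changes nothing. Column \<open>k\<close> is cleared by the choice of the
  pivot column.\<close>

lemma pivot_column_mult:
  assumes M: "M \<in> carrier (matrix_algebra n A)" and k: "k < n" and u: "M (k, k) \<in> Units A"
    and reduced: "\<And>i j. \<lbrakk>i < n; j < k\<rbrakk> \<Longrightarrow> M (i, j) = \<one>\<^bsub>matrix_algebra n A\<^esub> (i, j)"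
    and ij: "i < n" "j \<le> k"
  shows "(column_matrix A n k (pivot_column A k M) \<otimes>\<^bsub>matrix_algebra n A\<^esub> M) (i, j) =
    \<one>\<^bsub>matrix_algebra n A\<^esub> (i, j)"
proof -
  have "j < n"
    using ij k by simp
  then have entry: "(column_matrix A n k (pivot_column A k M) \<otimes>\<^bsub>matrix_algebra n A\<^esub> M) (i, j) =
      (if i = k then \<zero> else M (i, j)) \<oplus> pivot_column A k M i \<otimes> M (k, j)"
    using M k u ij(1) by (intro column_matrix_mult pivot_column_closed)
  have closed: "M (i, k) \<in> carrier A" "pivot_column A k M i \<in> carrier A"
    using matrix_entry_closed[OF M ij(1) k] pivot_column_closed[OF M k u ij(1)] by auto
  show ?thesis
  proof (cases "j = k")
    case True
    then show ?thesis
      using ij k u closed Units_closed[OF u] unfolding entry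
      by (auto simp: matrix_entries(2) pivot_column_def l_minus m_assoc r_neg)
  next
    case False
    then show ?thesis
      using ij k closed unfolding entry by (auto simp: reduced matrix_entries(2))
  qed
qed

end

section \<open>Complex scalars on matrices\<close>

lemma complex_field_simps:
  "carrier complex_field = UNIV"
  "a \<otimes>\<^bsub>complex_field\<^esub> b = a * b" "\<one>\<^bsub>complex_field\<^esub> = 1"
  "a \<oplus>\<^bsub>complex_field\<^esub> b = a + b" "\<zero>\<^bsub>complex_field\<^esub> = 0"
  by (simp_all add: ring_of_type_algebra_def)

context complex_algebra
begin

lemma matrix_smult_closed:
  assumes "M \<in> carrier (matrix_algebra n A)"
  shows "c \<odot>\<^bsub>matrix_algebra n A\<^esub> M \<in> carrier (matrix_algebra n A)"
  using assms smult_closed[of c, unfolded complex_field_simps] by (auto simp: matrix_algebra_def)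

end

lemma complex_algebra_matrix:
  fixes A :: "'a top_algebra" (structure)
  assumes "complex_algebra A"
  shows "complex_algebra (matrix_algebra n A)"
proof -
  interpret ring A
    by (rule complex_algebra.algebra_ring[OF assms])
  interpret T: complex_algebra A
    by (rule assms)
  let ?M = "matrix_algebra n A"
  interpret M: ring ?M
    by (rule ring_matrix[OF ring_axioms])
  \<comment> \<open>The module axioms over the record \<open>complex_field\<close> are restated with
    the arithmetic of the type \<open>complex\<close>, so that the simplifier can use them.\<close>
  note smult_facts = T.smult_closed[unfolded complex_field_simps, OF UNIV_I]
    T.smult_l_distr[unfolded complex_field_simps, OF UNIV_I UNIV_I]
    T.smult_r_distr[unfolded complex_field_simps, OF UNIV_I]
    T.smult_assoc1[unfolded complex_field_simps, OF UNIV_I UNIV_I]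
    T.smult_one[unfolded complex_field_simps]
  have finsum_smult: "c \<odot> (\<Oplus>k\<in>{..<n}. f k) = (\<Oplus>k\<in>{..<n}. c \<odot> f k)"
    if "\<And>k. k < n \<Longrightarrow> f k \<in> carrier A" for c f
    using T.finsum_smult_ldistr[of "{..<n}" c f] that by (simp add: complex_field_simps Pi_def)
  have "module complex_field ?M"
  proof (rule moduleI, unfold complex_field_simps)
    show "cring complex_field"
      by (rule cring_from_type_algebra)
    show "abelian_group ?M"
      by (rule M.is_abelian_group)
  next
    fix a b :: complex and x assume x: "x \<in> carrier ?M"
    note closed = matrix_entry_closed[OF x]
    show "a \<odot>\<^bsub>?M\<^esub> x \<in> carrier ?M"
      using x by (rule T.matrix_smult_closed)
    show "(a + b) \<odot>\<^bsub>?M\<^esub> x = a \<odot>\<^bsub>?M\<^esub> x \<oplus>\<^bsub>?M\<^esub> b \<odot>\<^bsub>?M\<^esub> x"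
      using x by (intro matrix_eqI[of _ n A] M.a_closed T.matrix_smult_closed)
        (simp_all add: matrix_entries closed smult_facts)
    show "(a * b) \<odot>\<^bsub>?M\<^esub> x = a \<odot>\<^bsub>?M\<^esub> (b \<odot>\<^bsub>?M\<^esub> x)"
      using x by (intro matrix_eqI[of _ n A] T.matrix_smult_closed)
        (simp_all add: matrix_entries closed smult_facts)
    show "1 \<odot>\<^bsub>?M\<^esub> x = x"
      using x by (intro matrix_eqI[of _ n A] T.matrix_smult_closed)
        (simp_all add: matrix_entries closed smult_facts)
  next
    fix a :: complex and x y assume xy: "x \<in> carrier ?M" "y \<in> carrier ?M"
    show "a \<odot>\<^bsub>?M\<^esub> (x \<oplus>\<^bsub>?M\<^esub> y) = a \<odot>\<^bsub>?M\<^esub> x \<oplus>\<^bsub>?M\<^esub> a \<odot>\<^bsub>?M\<^esub> y"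
      using xy by (intro matrix_eqI[of _ n A] M.a_closed T.matrix_smult_closed)
        (simp_all add: matrix_entries xy[THEN matrix_entry_closed] smult_facts)
  qed
  moreover have "(c \<odot>\<^bsub>?M\<^esub> x) \<otimes>\<^bsub>?M\<^esub> y = c \<odot>\<^bsub>?M\<^esub> (x \<otimes>\<^bsub>?M\<^esub> y)"
    and "x \<otimes>\<^bsub>?M\<^esub> (c \<odot>\<^bsub>?M\<^esub> y) = c \<odot>\<^bsub>?M\<^esub> (x \<otimes>\<^bsub>?M\<^esub> y)"
    if xy: "x \<in> carrier ?M" "y \<in> carrier ?M" for c x y
  proof -
    note closed = xy[THEN matrix_entry_closed]
    show "(c \<odot>\<^bsub>?M\<^esub> x) \<otimes>\<^bsub>?M\<^esub> y = c \<odot>\<^bsub>?M\<^esub> (x \<otimes>\<^bsub>?M\<^esub> y)"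
    proof (rule matrix_eqI)
      fix i j assume ij: "i < n" "j < n"
      have "((c \<odot>\<^bsub>?M\<^esub> x) \<otimes>\<^bsub>?M\<^esub> y) (i, j) = (\<Oplus>k\<in>{..<n}. c \<odot> (x (i, k) \<otimes> y (k, j)))"
        unfolding matrix_entries(1)[OF ij] using ij closed
        by (intro finsum_cong') (auto simp: matrix_entries T.smult_mult_left smult_facts)
      then show "((c \<odot>\<^bsub>?M\<^esub> x) \<otimes>\<^bsub>?M\<^esub> y) (i, j) = (c \<odot>\<^bsub>?M\<^esub> (x \<otimes>\<^bsub>?M\<^esub> y)) (i, j)"
        using ij closed by (simp add: matrix_entries finsum_smult)
    qed (use xy in \<open>auto simp: T.matrix_smult_closed\<close>)
    show "x \<otimes>\<^bsub>?M\<^esub> (c \<odot>\<^bsub>?M\<^esub> y) = c \<odot>\<^bsub>?M\<^esub> (x \<otimes>\<^bsub>?M\<^esub> y)"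
    proof (rule matrix_eqI)
      fix i j assume ij: "i < n" "j < n"
      have "(x \<otimes>\<^bsub>?M\<^esub> (c \<odot>\<^bsub>?M\<^esub> y)) (i, j) = (\<Oplus>k\<in>{..<n}. c \<odot> (x (i, k) \<otimes> y (k, j)))"
        unfolding matrix_entries(1)[OF ij] using ij closed
        by (intro finsum_cong') (auto simp: matrix_entries T.smult_mult_right smult_facts)
      then show "(x \<otimes>\<^bsub>?M\<^esub> (c \<odot>\<^bsub>?M\<^esub> y)) (i, j) = (c \<odot>\<^bsub>?M\<^esub> (x \<otimes>\<^bsub>?M\<^esub> y)) (i, j)"
        using ij closed by (simp add: matrix_entries finsum_smult)
    qed (use xy in \<open>auto simp: T.matrix_smult_closed\<close>)
  qed
  ultimately show ?thesis
    by (intro complex_algebra.intro complex_algebra_axioms.intro M.ring_axioms) auto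
qed

section \<open>Topology on matrices\<close>

context topological_algebra
begin

text \<open>The universal property of the product topology. The extensionality clause is there
  because a matrix must be \<open>undefined\<close> off the index set.\<close>

lemma continuous_map_matrix:
  "continuous_map T (topo (matrix_algebra n A)) f \<longleftrightarrow>
     f ` topspace T \<subseteq> extensional (mat_indices n) \<and>
     (\<forall>i<n. \<forall>j<n. continuous_map T (topo A) (\<lambda>x. f x (i, j)))"
  unfolding matrix_topo continuous_map_componentwise by auto

lemma continuous_map_entry:
  assumes "continuous_map T (topo (matrix_algebra n A)) f" "i < n" "j < n"
  shows "continuous_map T (topo A) (\<lambda>x. f x (i, j))"
  using assms by (simp add: continuous_map_matrix)

lemma topological_algebra_matrix: "topological_algebra (matrix_algebra n A)"
proof -
  let ?M = "matrix_algebra n A"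
  \<comment> \<open>In \<open>snd\<close> the first factor \<open>S\<close> is arbitrary, since it
    is the matrix space for the ring operations and the scalars for \<open>smult\<close>.\<close>
  have fst: "continuous_map (prod_topology (topo ?M) (topo ?M)) (topo A) (\<lambda>p. fst p (i, j))"
    and snd: "continuous_map (prod_topology S (topo ?M)) (topo A) (\<lambda>p. snd p (i, j))"
    if "i < n" "j < n" for i j and S :: "'c topology"
    using that by (auto intro!: continuous_map_entry continuous_map_fst continuous_map_snd)
  show ?thesis
  proof (intro topological_algebra.intro topological_algebra_axioms.intro
      complex_algebra_matrix complex_algebra_axioms)
    show "topspace (topo ?M) = carrier ?M"
      by (simp add: matrix_topo matrix_carrier topspace_topo)
    show "continuous_map (prod_topology (topo ?M) (topo ?M)) (topo ?M) (\<lambda>(x, y). x \<oplus>\<^bsub>?M\<^esub> y)"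
      unfolding continuous_map_matrix
      by (auto simp: split_beta matrix_entries intro!: continuous_map_add fst snd)
        (auto simp: matrix_algebra_def)
    show "continuous_map (prod_topology (topo ?M) (topo ?M)) (topo ?M) (\<lambda>(x, y). x \<otimes>\<^bsub>?M\<^esub> y)"
      unfolding continuous_map_matrix
      by (auto simp: split_beta matrix_entries intro!: continuous_map_finsum continuous_map_mult fst snd)
        (auto simp: matrix_algebra_def)
    show "continuous_map (prod_topology euclidean (topo ?M)) (topo ?M) (\<lambda>(c, x). c \<odot>\<^bsub>?M\<^esub> x)"
      unfolding continuous_map_matrix
      by (auto simp: split_beta matrix_entries intro!: continuous_map_smult snd continuous_map_fst)
        (auto simp: matrix_algebra_def)
  qed
qed

text \<open>Left translation by \<open>inv a\<close> is continuous and sends \<open>a\<close> to the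
  unit element, so the preimage of \<open>U\<close> is a neighbourhood of \<open>a\<close>. It
  consists of units because the factor \<open>inv a\<close> can be cancelled.\<close>

lemma open_Units_if_neighbourhood_one:
  assumes U: "openin (topo A) U" "\<one> \<in> U" "U \<subseteq> Units A"
  shows "openin (topo A) (Units A)"
proof (subst openin_subopen, intro ballI)
  fix a assume a: "a \<in> Units A"
  have "continuous_map (topo A) (topo A) (\<lambda>x. inv a \<otimes> x)"
    using continuous_map_mult[of "topo A" "\<lambda>_. inv a" "\<lambda>x. x"] a topspace_topo by simp
  then have "openin (topo A) {x \<in> carrier A. inv a \<otimes> x \<in> U}"
    using openin_continuous_map_preimage[OF _ U(1)] topspace_topo by fastforce
  moreover have "a \<in> {x \<in> carrier A. inv a \<otimes> x \<in> U}"
    using a U(2) by (simp add: monoid.Units_closed[OF ring.is_monoid[OF algebra_ring]])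
  moreover have "{x \<in> carrier A. inv a \<otimes> x \<in> U} \<subseteq> Units A"
    using monoid.Units_cancel_left[OF ring.is_monoid[OF algebra_ring], of "inv a"] a U(3) by blast
  ultimately show "\<exists>T. openin (topo A) T \<and> a \<in> T \<and> T \<subseteq> Units A"
    by blast
qed

end

section \<open>Openness of the units of a matrix algebra\<close>

context good_topological_algebra
begin

lemma continuous_map_inv:
  assumes "continuous_map T (topo A) f" "\<And>x. x \<in> topspace T \<Longrightarrow> f x \<in> Units A"
  shows "continuous_map T (topo A) (\<lambda>x. inv (f x))"
proof -
  have "continuous_map T (subtopology (topo A) (Units A)) f"
    using assms by (intro continuous_map_into_subtopology) auto
  from continuous_map_compose[OF this continuous_inv] show ?thesis
    by (simp add: o_def)
qed

text \<open>Column elimination: a matrix close to the identity whose first \<open>k\<close> columns are those of the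
  identity has an invertible entry at \<open>(k, k)\<close>, and clearing column \<open>k\<close> is continuous, so it leads
  to a matrix that is again close to the identity.\<close>

lemma matrix_Units_near_one:
  assumes "k \<le> n"
  shows "\<exists>U. openin (topo (matrix_algebra n A)) U \<and> \<one>\<^bsub>matrix_algebra n A\<^esub> \<in> U \<and>
    (\<forall>M\<in>U. (\<forall>i<n. \<forall>j<k. M (i, j) = \<one>\<^bsub>matrix_algebra n A\<^esub> (i, j)) \<longrightarrow>
      M \<in> Units (matrix_algebra n A))"
  using assms
\<comment> \<open>The induction descends from \<open>k = n\<close>, where the condition on the
  columns leaves only the identity.\<close>
proof (induction rule: inc_induct)
  let ?M = "matrix_algebra n A"
  interpret M: ring ?M
    by (rule ring_matrix[OF algebra_ring])
  interpret T: topological_algebra ?M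
    by (rule topological_algebra_matrix)
  case base
  have "M = \<one>\<^bsub>?M\<^esub>" if "M \<in> carrier ?M" "\<forall>i<n. \<forall>j<n. M (i, j) = \<one>\<^bsub>?M\<^esub> (i, j)" for M
    using that by (intro matrix_eqI[of _ n A] M.one_closed) auto
  moreover have "openin (topo ?M) (carrier ?M)"
    using T.topspace_topo openin_topspace by metis
  ultimately show ?case
    using M.Units_one_closed M.one_closed by blast
next
  let ?M = "matrix_algebra n A"
  interpret M: ring ?M
    by (rule ring_matrix[OF algebra_ring])
  interpret T: topological_algebra ?M
    by (rule topological_algebra_matrix)
  case (step k)
  note k = \<open>k < n\<close>
  obtain U where U: "openin (topo ?M) U" "\<one>\<^bsub>?M\<^esub> \<in> U"
    and *: "\<forall>M\<in>U. (\<forall>i<n. \<forall>j<Suc k. M (i, j) = \<one>\<^bsub>?M\<^esub> (i, j)) \<longrightarrow> M \<in> Units ?M"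
    using step.IH by (elim exE conjE)
  have unit: "M \<in> Units ?M"
    if "M \<in> U" "\<And>i j. \<lbrakk>i < n; j < Suc k\<rbrakk> \<Longrightarrow> M (i, j) = \<one>\<^bsub>?M\<^esub> (i, j)" for M
    using that by (intro *[THEN bspec, THEN mp] allI impI)
  \<comment> \<open>On \<open>W\<close> the pivot is invertible, and \<open>R M\<close> is the
    matrix obtained from \<open>M\<close> by clearing column \<open>k\<close>.\<close>
  define W where "W = {M \<in> carrier ?M. M (k, k) \<in> Units A}"
  define C where "C M = column_matrix A n k (pivot_column A k M)" for M
  define R where "R M = C M \<otimes>\<^bsub>?M\<^esub> M" for M
  have W_carrier: "M \<in> carrier ?M" and W_unit: "M (k, k) \<in> Units A" if "M \<in> W" for M
    using that by (auto simp: W_def)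
  have C_unit: "C M \<in> Units ?M" if "M \<in> W" for M
    unfolding C_def using that k
    by (intro pivot_column_matrix_Units algebra_ring W_carrier W_unit)
  have R_closed: "R M \<in> carrier ?M" if "M \<in> W" for M
    unfolding R_def using that by (intro M.m_closed M.Units_closed C_unit W_carrier)
  have R_entry: "R M (i, j) = (if i = k then \<zero> else M (i, j)) \<oplus> pivot_column A k M i \<otimes> M (k, j)"
    if "M \<in> W" "i < n" "j < n" for M i j
    unfolding R_def C_def using that k W_carrier[OF that(1)] W_unit[OF that(1)]
    by (intro column_matrix_mult pivot_column_closed algebra_ring)
  have W_open: "openin (topo ?M) W"
    using openin_continuous_map_preimage[OF continuous_map_entry[OF continuous_map_id k k] open_Units]
    by (simp add: W_def T.topspace_topo)
  have topspace_W: "topspace (subtopology (topo ?M) W) = W"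
    using openin_subset[OF W_open] by auto
  have entry: "continuous_map (subtopology (topo ?M) W) (topo A) (\<lambda>M. M (i, j))"
    if "i < n" "j < n" for i j
    using that by (intro continuous_map_entry[where f = "\<lambda>M. M"]) (auto intro: continuous_map_from_subtopology)
  \<comment> \<open>Here the continuity of inversion in \<open>A\<close> enters; the remaining
    ingredients of the entries of \<open>R M\<close> are sums, products and negatives.\<close>
  have entry_inv: "continuous_map (subtopology (topo ?M) W) (topo A) (\<lambda>M. inv (M (k, k)))"
    using k by (intro continuous_map_inv entry) (auto simp: W_def)
  have "continuous_map (subtopology (topo ?M) W) (topo A) (\<lambda>M. R M (i, j))" if ij: "i < n" "j < n" for i j
  proof -
    have "continuous_map (subtopology (topo ?M) W) (topo A)
        (\<lambda>M. (if i = k then \<zero> else M (i, j)) \<oplus> pivot_column A k M i \<otimes> M (k, j))"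
      using ij k topspace_topo
      by (auto simp: pivot_column_def
          intro!: continuous_map_add continuous_map_mult continuous_map_a_inv entry entry_inv)
    then show ?thesis
      by (rule continuous_map_eq) (use ij topspace_W in \<open>auto simp: R_entry\<close>)
  qed
  then have "continuous_map (subtopology (topo ?M) W) (topo ?M) R"
    using R_closed topspace_W by (auto simp: continuous_map_matrix matrix_carrier PiE_def)
  \<comment> \<open>The new neighbourhood consists of the matrices whose reduction lands in the
    neighbourhood \<open>U\<close> given by the induction hypothesis.\<close>
  then have "openin (subtopology (topo ?M) W) {M \<in> W. R M \<in> U}"
    using openin_continuous_map_preimage[OF _ U(1)] topspace_W by fastforce
  then have "openin (topo ?M) {M \<in> W. R M \<in> U}"
    using W_open openin_trans_full by blast
  moreover have "\<one>\<^bsub>?M\<^esub> \<in> {M \<in> W. R M \<in> U}"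
  proof -
    have one: "\<one>\<^bsub>?M\<^esub> \<in> W"
      using k by (simp add: W_def matrix_entries)
    \<comment> \<open>The identity has nothing to eliminate, so reduction fixes it and the new set
      still contains it.\<close>
    have "C \<one>\<^bsub>?M\<^esub> = \<one>\<^bsub>?M\<^esub>"
      using k by (intro matrix_eqI[of _ n A] M.Units_closed[OF C_unit] M.one_closed one)
        (auto simp: C_def column_matrix_def pivot_column_def matrix_entries)
    then show ?thesis
      using one U(2) by (simp add: R_def)
  qed
  moreover have "M \<in> Units ?M"
    if M: "M \<in> {M \<in> W. R M \<in> U}" "\<forall>i<n. \<forall>j<k. M (i, j) = \<one>\<^bsub>?M\<^esub> (i, j)" for M
  proof -
    have MW: "M \<in> W"
      using M(1) by simp
    \<comment> \<open>Reduction increases the number of cleared columns from \<open>k\<close> to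
      \<open>Suc k\<close>, so the induction hypothesis applies to \<open>R M\<close>; the unit
      \<open>C M\<close> is then cancelled.\<close>
    have "R M (i, j) = \<one>\<^bsub>?M\<^esub> (i, j)" if "i < n" "j < Suc k" for i j
      unfolding R_def C_def using that M(2) W_carrier[OF MW] W_unit[OF MW] k
      by (intro pivot_column_mult algebra_ring) auto
    then have "R M \<in> Units ?M"
      using unit M(1) by blast
    then show ?thesis
      using M.Units_cancel_left[of "C M" M] C_unit[OF MW] W_carrier[OF MW] by (simp add: R_def)
  qed
  ultimately show ?case
    by blast
qed

lemma open_units_algebra_matrix: "open_units_algebra (matrix_algebra n A)"
proof -
  interpret M: topological_algebra "matrix_algebra n A"
    by (rule topological_algebra_matrix)
  show ?thesis
    \<comment> \<open>For \<open>k = 0\<close> the condition on the columns is vacuous, so the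
      neighbourhood consists of units.\<close>
    using matrix_Units_near_one[of 0 n] M.open_Units_if_neighbourhood_one
    by unfold_locales blast
qed

end

section \<open>Amplification of morphisms\<close>

lemma matrix_map_image: "matrix_map n \<phi> ` (mat_indices n \<rightarrow>\<^sub>E S) = (mat_indices n \<rightarrow>\<^sub>E \<phi> ` S)"
proof (intro equalityI subsetI)
  fix N assume N: "N \<in> mat_indices n \<rightarrow>\<^sub>E \<phi> ` S"
  then have "\<forall>p\<in>mat_indices n. \<exists>x\<in>S. N p = \<phi> x"
    by blast
  then obtain g where g: "\<And>p. p \<in> mat_indices n \<Longrightarrow> g p \<in> S \<and> N p = \<phi> (g p)"
    by metis
  then have "N = matrix_map n \<phi> (restrict g (mat_indices n))"
    using N by (intro PiE_ext[OF N]) (auto simp: matrix_map_def)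
  moreover have "restrict g (mat_indices n) \<in> mat_indices n \<rightarrow>\<^sub>E S"
    using g by simp
  ultimately show "N \<in> matrix_map n \<phi> ` (mat_indices n \<rightarrow>\<^sub>E S)"
    by blast
qed (auto simp: matrix_map_def)

lemma dense_morphism_matrix:
  assumes "topological_algebra A" "topological_algebra B" "dense_morphism A B \<phi>"
  shows "dense_morphism (matrix_algebra n A) (matrix_algebra n B) (matrix_map n \<phi>)"
proof -
  interpret A: ring A
    using assms(1) by (simp add: topological_algebra_def complex_algebra_def)
  interpret B: ring B
    using assms(2) by (simp add: topological_algebra_def complex_algebra_def)
  interpret TA: topological_algebra A by fact
  interpret TB: topological_algebra B by fact
  let ?A = "matrix_algebra n A" and ?B = "matrix_algebra n B"
  have hom: "\<phi> \<in> ring_hom A B" and smult: "\<And>c x. x \<in> carrier A \<Longrightarrow> \<phi> (c \<odot>\<^bsub>A\<^esub> x) = c \<odot>\<^bsub>B\<^esub> \<phi> x"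
    and cont: "continuous_map (topo A) (topo B) \<phi>"
    and dense: "topo B closure_of (\<phi> ` carrier A) = carrier B"
    using assms(3) by (auto simp: dense_morphism_def morphism_def dense_subset_def)
  interpret ring_hom_ring A B \<phi>
    using hom by (intro ring_hom_ringI2 A.ring_axioms B.ring_axioms)
  interpret MA: ring ?A
    by (rule ring_matrix[OF A.ring_axioms])
  interpret MB: ring ?B
    by (rule ring_matrix[OF B.ring_axioms])
  have entry: "matrix_map n \<phi> M (i, j) = \<phi> (M (i, j))" if "i < n" "j < n" for M i j
    using that by (simp add: matrix_map_def)
  have closed: "matrix_map n \<phi> M \<in> carrier ?B" if "M \<in> carrier ?A" for M
    using that ring_hom_closed[OF hom] unfolding matrix_map_def matrix_carrier
    by (intro restrict_PiE_iff[THEN iffD2] ballI) blast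
  have "matrix_map n \<phi> \<in> ring_hom ?A ?B"
  proof (rule ring_hom_memI)
    fix M N assume MN: "M \<in> carrier ?A" "N \<in> carrier ?A"
    note c = MN[THEN matrix_entry_closed]
    show "matrix_map n \<phi> (M \<otimes>\<^bsub>?A\<^esub> N) = matrix_map n \<phi> M \<otimes>\<^bsub>?B\<^esub> matrix_map n \<phi> N"
    proof (rule matrix_eqI[of _ n B])
      fix i j assume ij: "i < n" "j < n"
      have "\<phi> (\<Oplus>\<^bsub>A\<^esub>k\<in>{..<n}. M (i, k) \<otimes>\<^bsub>A\<^esub> N (k, j)) = (\<Oplus>\<^bsub>B\<^esub>k\<in>{..<n}. \<phi> (M (i, k) \<otimes>\<^bsub>A\<^esub> N (k, j)))"
        using c ij by (subst hom_finsum) (auto simp: o_def)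
      also have "\<dots> = (\<Oplus>\<^bsub>B\<^esub>k\<in>{..<n}. matrix_map n \<phi> M (i, k) \<otimes>\<^bsub>B\<^esub> matrix_map n \<phi> N (k, j))"
        using c ij by (intro B.finsum_cong') (auto simp: entry)
      finally show "matrix_map n \<phi> (M \<otimes>\<^bsub>?A\<^esub> N) (i, j) = (matrix_map n \<phi> M \<otimes>\<^bsub>?B\<^esub> matrix_map n \<phi> N) (i, j)"
        using ij by (simp add: entry matrix_entries)
    qed (intro closed MN MA.m_closed MB.m_closed)+
    show "matrix_map n \<phi> (M \<oplus>\<^bsub>?A\<^esub> N) = matrix_map n \<phi> M \<oplus>\<^bsub>?B\<^esub> matrix_map n \<phi> N"
      by (intro matrix_eqI[of _ n B] closed MN MA.a_closed MB.a_closed)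
        (simp add: entry matrix_entries c)
  next
    show "matrix_map n \<phi> \<one>\<^bsub>?A\<^esub> = \<one>\<^bsub>?B\<^esub>"
      by (intro matrix_eqI[of _ n B] closed MA.one_closed MB.one_closed)
        (simp add: entry matrix_entries)
  qed (rule closed)
  moreover have "matrix_map n \<phi> (c \<odot>\<^bsub>?A\<^esub> M) = c \<odot>\<^bsub>?B\<^esub> matrix_map n \<phi> M" if "M \<in> carrier ?A" for c M
    using that by (intro matrix_eqI[of _ n B] closed TA.matrix_smult_closed TB.matrix_smult_closed)
      (simp_all add: entry matrix_entries matrix_entry_closed[OF that] smult)
  moreover have "continuous_map (topo ?A) (topo ?B) (matrix_map n \<phi>)"
  proof -
    have "continuous_map (topo ?A) (topo B) (\<lambda>M. \<phi> (M (i, j)))" if "i < n" "j < n" for i j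
      using continuous_map_compose[OF TA.continuous_map_entry[OF continuous_map_id that] cont]
      by (simp add: o_def)
    then show ?thesis
      by (simp add: TB.continuous_map_matrix entry image_subset_iff) (simp add: matrix_map_def)
  qed
  \<comment> \<open>The image is the full product of copies of the image of \<phi>, and the closure
    of a product is the product of the closures.\<close>
  moreover have "dense_subset (matrix_map n \<phi> ` carrier ?A) ?B"
    unfolding dense_subset_def matrix_carrier matrix_topo matrix_map_image closure_of_product_topology dense
    using ring_hom_closed[OF hom] by (intro conjI refl PiE_mono) blast
  ultimately show ?thesis
    by (simp add: dense_morphism_def morphism_def)
qed

theorem proposition4p1:
  fixes A :: "'a top_algebra" and B :: "'b top_algebra" and \<phi> :: "'a \<Rightarrow> 'b"
  assumes "good_topological_algebra A" and "good_topological_algebra B"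
    and "dense_morphism A B \<phi>"
  shows "(relatively_spectral A B \<phi> \<longrightarrow>
            (finite_algebra A \<longleftrightarrow> finite_algebra B)) \<and>
         (completely_relatively_spectral A B \<phi> \<longrightarrow>
            (stably_finite_algebra A \<longleftrightarrow> stably_finite_algebra B))"
proof -
  interpret A: good_topological_algebra A by fact
  interpret B: good_topological_algebra B by fact
  have "finite_algebra (matrix_algebra n A) \<longleftrightarrow> finite_algebra (matrix_algebra n B)"
    if "completely_relatively_spectral A B \<phi>" "n \<ge> 1" for n
    using that
    by (intro finite_algebra_iff[OF A.open_units_algebra_matrix B.open_units_algebra_matrix
          dense_morphism_matrix[OF A.topological_algebra_axioms B.topological_algebra_axioms assms(3)]])
      (simp add: completely_relatively_spectral_def)
  then show ?thesis
    using finite_algebra_iff[OF A.open_units_algebra_axioms B.open_units_algebra_axioms assms(3)]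
    by (simp add: stably_finite_algebra_def)
qed

end
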